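(* Let $H$ be a ribbon hypermap and $A\subseteq E(H)$, $A^c=E(H)\setminus A$. Then $$\chi(H^{A})=\chi(A)+\chi(A^{c})-2v(H).$$
   Context: A ribbon hypermap $H$ is a (possibly non-orientable) surface with boundary, written as the union of two sets of discs, the hypervertices $V(H)$ and the hyperedges $E(H)$, such that hypervertices and hyperedges meet in disjoint line segments (common line segments), each lying on the boundary of exactly one hypervertex and exactly one hyperedge. Hyperfaces are the boundary components of the surface. $v(H),e(H),f(H)$ are the numbers of hypervertices, hyperedges, hyperfaces; $d(e)$ is the number of common line segments on hyperedge $e$ and $d(H)=\sum_e d(e)$. The Euler characteristic (for $H$ connected or not) is $\chi(H)=v(H)+e(H)+f(H)-d(H)$. For $A\subseteq E(H)$, $A$ also denotes the sub-ribbon hypermap obtained from $H$ by deleting all hyperedges not in $A$ but keeping all hypervertices (even isolated ones). Partial dual $H^A$: in an arrow presentation of $H$ (hypervertices as closed curves; each hyperedge $e$ as arrows $e_1,\dots,e_{d(e)}$ along its common line segments in cyclic order around $e$), for each $e\in A$ and each $i$ draw a new arrow from the head of $e_i$ to the tail of $e_{i+1}$ (indices mod $d(e)$), label it $e_i$, and delete the original arrows; the new arrows become arcs of the closed curves of the arrow presentation of $H^A$ (equivalently, the hypervertices of $H^A$ are the boundary components of the sub-ribbon hypermap $A$, and the hyperedges are unchanged). *)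

theory Defs
  imports Main
begin

text \<open>
  Ribbon hypermaps are encoded by their arrow presentations.  The boundary of a hyperedge \<open>e\<close>
  with \<open>d\<close> common line segments is oriented once and for all; its segments are the arrows
  \<open>(e, 0), \<dots>, (e, d - 1)\<close>, listed in the cyclic order around \<open>e\<close> and all directed along that
  orientation.  So the boundary of \<open>e\<close> runs along arrow \<open>i\<close> from tail to head, and then along a
  free arc from the head of arrow \<open>i\<close> to the tail of arrow \<open>i + 1\<close> (modulo \<open>d\<close>).
\<close>

datatype 'e arrow_end = Tail 'e nat | Head 'e nat

fun other_end :: "'e arrow_end \<Rightarrow> 'e arrow_end" where
  "other_end (Tail e i) = Head e i"
| "other_end (Head e i) = Tail e i"

definition arrow_ends :: "'e set \<Rightarrow> ('e \<Rightarrow> nat) \<Rightarrow> 'e arrow_end set" where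
  "arrow_ends E d = (\<Union>e\<in>E. \<Union>i<d e. {Tail e i, Head e i})"

text \<open>
  The closed curves of an arrow presentation that carry at least one arrow are cut by the arrows
  into arcs; \<open>arc\<close> sends an arrow end to the arrow end at the other side of the arc that starts
  there.  Travelling along such a curve thus means applying \<open>arc\<close> and \<open>other_end\<close> alternately.
  Since \<open>arc\<close> may join heads to heads, non-orientable surfaces are included.  The curves without
  arrows, which are the isolated hypervertices, leave no trace in \<open>arc\<close>; \<open>bare\<close> is their number.
  A hyperedge \<open>e\<close> with \<open>hdeg e = 0\<close> is a disc that meets no hypervertex.
\<close>

record 'e arrow_presentation =
  hedges :: "'e set"
  hdeg :: "'e \<Rightarrow> nat"
  arc :: "'e arrow_end \<Rightarrow> 'e arrow_end"
  bare :: nat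

abbreviation ends :: "'e arrow_presentation \<Rightarrow> 'e arrow_end set" where
  "ends H \<equiv> arrow_ends (hedges H) (hdeg H)"

definition ribbon_hypermap :: "'e arrow_presentation \<Rightarrow> bool" where
  "ribbon_hypermap H \<longleftrightarrow> finite (hedges H) \<and>
     (\<forall>x\<in>ends H. arc H x \<in> ends H \<and> arc H x \<noteq> x \<and> arc H (arc H x) = x)"

text \<open>The free arcs on the boundaries of the hyperedges.\<close>

fun hedge_arc :: "'e arrow_presentation \<Rightarrow> 'e arrow_end \<Rightarrow> 'e arrow_end" where
  "hedge_arc H (Head e i) = Tail e (Suc i mod hdeg H e)"
| "hedge_arc H (Tail e i) = Head e ((i + hdeg H e - 1) mod hdeg H e)"

text \<open>For two involutions of \<open>X\<close>, the closed curves traced out by applying them alternately.\<close>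

definition closed_curves ::
    "'a set \<Rightarrow> ('a \<Rightarrow> 'a) \<Rightarrow> ('a \<Rightarrow> 'a) \<Rightarrow> 'a set set" where
  "closed_curves X f g = X // ((\<lambda>x. (x, f x)) ` X \<union> (\<lambda>x. (x, g x)) ` X)\<^sup>*"

abbreviation hvertex_curves :: "'e arrow_presentation \<Rightarrow> 'e arrow_end set set" where
  "hvertex_curves H \<equiv> closed_curves (ends H) (arc H) other_end"

definition num_hvertices :: "'e arrow_presentation \<Rightarrow> nat" where
  "num_hvertices H = card (hvertex_curves H) + bare H"

definition num_hedges :: "'e arrow_presentation \<Rightarrow> nat" where
  "num_hedges H = card (hedges H)"

text \<open>
  A boundary component of the surface consists of free arcs of hypervertices and of hyperedges
  alternately, unless it is the whole boundary of an isolated hypervertex or hyperedge.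
\<close>

definition num_hfaces :: "'e arrow_presentation \<Rightarrow> nat" where
  "num_hfaces H = card (closed_curves (ends H) (arc H) (hedge_arc H)) + bare H
     + card {e \<in> hedges H. hdeg H e = 0}"

definition num_segments :: "'e arrow_presentation \<Rightarrow> nat" where
  "num_segments H = (\<Sum>e\<in>hedges H. hdeg H e)"

definition euler_char :: "'e arrow_presentation \<Rightarrow> int" where
  "euler_char H = int (num_hvertices H) + int (num_hedges H) + int (num_hfaces H)
     - int (num_segments H)"

text \<open>
  The sub-ribbon hypermap \<open>A\<close>, obtained by deleting the hyperedges outside \<open>A\<close> and keeping all
  hypervertices.  Starting from an arrow end that remains, the new arc runs through all deleted
  arrows up to the first arrow end that remains.  Curves that lose all their arrows become bare.
\<close>

definition sub_arc ::
    "'e arrow_presentation \<Rightarrow> 'e set \<Rightarrow> 'e arrow_end \<Rightarrow> 'e arrow_end" where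
  "sub_arc H A x =
     (let walk = (\<lambda>k. ((arc H \<circ> other_end) ^^ k) (arc H x))
      in walk (LEAST k. walk k \<in> arrow_ends A (hdeg H)))"

definition sub_hypermap :: "'e arrow_presentation \<Rightarrow> 'e set \<Rightarrow> 'e arrow_presentation" where
  "sub_hypermap H A = H\<lparr>
     hedges := A,
     arc := sub_arc H A,
     bare := bare H + card {C \<in> hvertex_curves H. C \<inter> arrow_ends A (hdeg H) = {}}\<rparr>"

text \<open>
  In the partial dual with respect to \<open>A\<close>, the new arrow \<open>i\<close> of \<open>e \<in> A\<close> is drawn from the head of
  the old arrow \<open>i\<close> to the tail of the old arrow \<open>i + 1\<close>.  \<open>place H A\<close> sends each end of a new
  arrow to the end of an old arrow where it is located.  The old arrows of \<open>A\<close> are deleted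
  together with the segments of the curves along which they lie, so that the remaining arcs of
  the old curves become the arcs between the new arrows.
\<close>

fun place :: "'e arrow_presentation \<Rightarrow> 'e set \<Rightarrow> 'e arrow_end \<Rightarrow> 'e arrow_end" where
  "place H A (Tail e i) = (if e \<in> A then Head e i else Tail e i)"
| "place H A (Head e i) = (if e \<in> A then Tail e (Suc i mod hdeg H e) else Head e i)"

definition partial_dual :: "'e arrow_presentation \<Rightarrow> 'e set \<Rightarrow> 'e arrow_presentation" where
  "partial_dual H A = H\<lparr>arc := \<lambda>x. inv_into (ends H) (place H A) (arc H (place H A x))\<rparr>"


text \<open>Both constructions yield ribbon hypermaps.\<close>

lemma other_end_other_end [simp]: "other_end (other_end x) = x"
  by (cases x) auto

lemma other_end_neq [simp]: "other_end x \<noteq> x"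
  by (cases x) auto

lemma Tail_in_arrow_ends [simp]: "Tail e i \<in> arrow_ends E d \<longleftrightarrow> e \<in> E \<and> i < d e"
  and Head_in_arrow_ends [simp]: "Head e i \<in> arrow_ends E d \<longleftrightarrow> e \<in> E \<and> i < d e"
  by (auto simp: arrow_ends_def)

lemma other_end_in_arrow_ends [simp]: "other_end x \<in> arrow_ends E d \<longleftrightarrow> x \<in> arrow_ends E d"
  by (cases x) auto

lemma finite_arrow_ends: "finite E \<Longrightarrow> finite (arrow_ends E d)"
  by (auto simp: arrow_ends_def)

lemma Suc_mod_inj:
  assumes "i < n" "j < n" "Suc i mod n = Suc j mod n"
  shows "i = j"
  using assms by (auto simp: mod_Suc split: if_splits)

lemma bij_betw_place:
  assumes "finite (hedges H)"
  shows "bij_betw (place H A) (ends H) (ends H)"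
proof -
  have into: "place H A ` ends H \<subseteq> ends H"
  proof clarify
    fix x assume "x \<in> ends H"
    then show "place H A x \<in> ends H"
      by (cases x) auto
  qed
  moreover have inj: "inj_on (place H A) (ends H)"
  proof (rule inj_onI)
    fix x y assume "x \<in> ends H" "y \<in> ends H" "place H A x = place H A y"
    then show "x = y"
      by (cases x; cases y) (auto split: if_splits dest: Suc_mod_inj)
  qed
  ultimately show ?thesis
    using endo_inj_surj[OF finite_arrow_ends[OF assms]] by (auto simp: bij_betw_def)
qed

lemma ribbon_hypermap_partial_dual:
  assumes "ribbon_hypermap H"
  shows "ribbon_hypermap (partial_dual H A)"
proof -
  have fin: "finite (hedges H)"
    and arc: "\<And>x. x \<in> ends H \<Longrightarrow> arc H x \<in> ends H \<and> arc H x \<noteq> x \<and> arc H (arc H x) = x"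
    using assms by (auto simp: ribbon_hypermap_def)
  let ?p = "place H A" and ?q = "inv_into (ends H) (place H A)"
  note bij = bij_betw_place[OF fin, of A]
  have p: "?p x \<in> ends H" "?q x \<in> ends H" "?p (?q x) = x" "?q (?p x) = x" if "x \<in> ends H" for x
    using bij that by (auto simp: bij_betw_def inv_into_into f_inv_into_f)
  have "?q (arc H (?p x)) \<in> ends H \<and> ?q (arc H (?p x)) \<noteq> x \<and>
      ?q (arc H (?p (?q (arc H (?p x))))) = x" if "x \<in> ends H" for x
  proof -
    have px: "?p x \<in> ends H" using p that by blast
    then have a: "arc H (?p x) \<in> ends H" "arc H (?p x) \<noteq> ?p x" "arc H (arc H (?p x)) = ?p x"
      using arc by blast+
    have "?p (?q (arc H (?p x))) = arc H (?p x)" by (rule p(3)[OF a(1)])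
    then show ?thesis using p(2)[OF a(1)] p(4)[OF that] a by auto
  qed
  then show ?thesis
    using fin by (simp add: ribbon_hypermap_def partial_dual_def)
qed

lemma ribbon_hypermap_sub_hypermap:
  assumes "ribbon_hypermap H" "A \<subseteq> hedges H"
  shows "ribbon_hypermap (sub_hypermap H A)"
proof -
  define X K f where "X = ends H" and "K = arrow_ends A (hdeg H)" and "f = arc H"
  define s where "s = f \<circ> other_end"
  have fin: "finite X" and f: "\<And>x. x \<in> X \<Longrightarrow> f x \<in> X \<and> f x \<noteq> x \<and> f (f x) = x"
    using assms by (auto simp: ribbon_hypermap_def X_def f_def finite_arrow_ends)
  have KX: "K \<subseteq> X"
    using assms(2) by (auto simp: K_def X_def arrow_ends_def)
  have g: "other_end x \<in> X \<longleftrightarrow> x \<in> X" "other_end x \<in> K \<longleftrightarrow> x \<in> K" for x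
    by (simp_all add: X_def K_def)
  have sX: "(s ^^ k) x \<in> X" if "x \<in> X" for k x
    using that f g by (induction k) (auto simp: s_def)
  have s_inj: "x = y" if "x \<in> X" "y \<in> X" "s x = s y" for x y
    using that f g by (metis comp_apply other_end_other_end s_def)
  have sk_inj: "x = y" if "x \<in> X" "y \<in> X" "(s ^^ k) x = (s ^^ k) y" for x y k
    using that by (induction k) (auto intro: s_inj sX)
  have s_apply: "s z = f (other_end z)" for z
    by (simp add: s_def)
  have s_Suc: "(s ^^ Suc k) z = f (other_end ((s ^^ k) z))" for k z
    unfolding funpow.simps comp_apply by (rule s_apply)
  have s_Suc2: "(s ^^ Suc k) z = (s ^^ k) (f (other_end z))" for k z
    unfolding funpow_Suc_right comp_apply s_apply ..
  have ret: "\<exists>k. (s ^^ k) (f x) \<in> K" if "x \<in> K" for x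
  proof -
    have "x \<in> X" "other_end x \<in> X" "other_end x \<in> K" using that KX g by auto
    have "\<not> inj (\<lambda>k. (s ^^ k) (other_end x))"
      using finite_subset[OF _ fin, of "range (\<lambda>k. (s ^^ k) (other_end x))"]
        sX[OF \<open>other_end x \<in> X\<close>] finite_imageD by blast
    then have "\<exists>i j. i < j \<and> (s ^^ i) (other_end x) = (s ^^ j) (other_end x)"
      by (rule contrapos_np) (intro linorder_injI, auto)
    then obtain i j where "i < j" and eq: "(s ^^ i) (other_end x) = (s ^^ j) (other_end x)"
      by blast
    from \<open>i < j\<close> obtain m where j: "j = i + Suc m"
      by (auto dest: less_imp_Suc_add)
    have "(s ^^ i) (other_end x) = (s ^^ i) ((s ^^ Suc m) (other_end x))"
      using eq unfolding j funpow_add comp_apply .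
    then have "other_end x = (s ^^ Suc m) (other_end x)"
      by (intro sk_inj[of "other_end x" "(s ^^ Suc m) (other_end x)" i] sX
        \<open>other_end x \<in> X\<close>)
    then have "(s ^^ m) (f x) = other_end x"
      by (simp add: s_Suc2 del: funpow.simps)
    then show ?thesis using \<open>other_end x \<in> K\<close> by metis
  qed
  have reverse: "(s ^^ j) (f ((s ^^ (j + m)) (f x))) =
      (if m = 0 then x else other_end ((s ^^ (m - 1)) (f x)))"
    if "x \<in> X" for x j m
  proof (induction j)
    case 0
    show ?case
    proof (cases m)
      case 0 then show ?thesis using f that by simp
    next
      case (Suc m')
      have "other_end ((s ^^ m') (f x)) \<in> X" using sX f g that by blast
      then show ?thesis using Suc f by (simp add: s_Suc del: funpow.simps)
    qed
  next
    case (Suc j)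
    have *: "other_end ((s ^^ (j + m)) (f x)) \<in> X" using sX f g that by blast
    have "f (other_end (f ((s ^^ (Suc j + m)) (f x)))) = f ((s ^^ (j + m)) (f x))"
      using f[OF *] by (simp add: s_Suc del: funpow.simps)
    then have "(s ^^ Suc j) (f ((s ^^ (Suc j + m)) (f x))) = (s ^^ j) (f ((s ^^ (j + m)) (f x)))"
      unfolding s_Suc2[of j "f _"] by (rule arg_cong)
    with Suc show ?case by simp
  qed
  have no_fix: "(s ^^ k) (f x) \<noteq> x" if "x \<in> X" for k x
    using that
  proof (induction k arbitrary: x rule: less_induct)
    case (less k)
    show ?case
    proof (cases k)
      case 0 then show ?thesis using f less.prems by simp
    next
      case (Suc k')
      show ?thesis
      proof
        assume eq: "(s ^^ k) (f x) = x"
        let ?y = "(s ^^ k') (f x)"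
        have y: "?y \<in> X" "other_end ?y \<in> X" using sX f g less.prems by blast+
        have "f (other_end ?y) = x" using eq Suc by (simp add: s_Suc del: funpow.simps)
        then have fx: "f x = other_end ?y" using f y by metis
        show False
        proof (cases k')
          case 0
          then show ?thesis using fx by (metis funpow_0 other_end_neq)
        next
          case (Suc k'')
          let ?z = "other_end (f x)"
          have "(s ^^ k'') (f ?z) = ?y"
            using Suc by (simp add: s_Suc2 del: funpow.simps)
          also have "?y = ?z" using fx by (metis other_end_other_end)
          finally show ?thesis
            using less.IH[of k'' ?z] Suc \<open>k = Suc k'\<close> f g less.prems by auto
        qed
      qed
    qed
  qed
  have main: "sub_arc H A x \<in> K \<and> sub_arc H A x \<noteq> x \<and> sub_arc H A (sub_arc H A x) = x"
    if "x \<in> K" for x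
  proof -
    have sub: "sub_arc H A z = (s ^^ (LEAST k. (s ^^ k) (f z) \<in> K)) (f z)" for z
      by (simp add: sub_arc_def s_def f_def K_def)
    define k where "k = (LEAST k. (s ^^ k) (f x) \<in> K)"
    define y where "y = (s ^^ k) (f x)"
    have x: "x \<in> X" using that KX by auto
    have yK: "y \<in> K" unfolding y_def k_def using ret[OF that] by (rule LeastI_ex)
    have min: "(s ^^ j) (f x) \<notin> K" if "j < k" for j
      using that not_less_Least unfolding k_def by blast
    have y0: "(s ^^ k) (f y) = x"
      using reverse[OF x, of k 0] by (simp add: y_def)
    have "(s ^^ j) (f y) \<notin> K" if "j < k" for j
      using reverse[OF x, of j "k - j"] min[of "k - j - 1"] that g by (simp add: y_def)
    then have "(LEAST k. (s ^^ k) (f y) \<in> K) = k"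
      using y0 that by (intro Least_equality) (auto simp: not_less[symmetric])
    then show ?thesis
      using yK y0 no_fix[OF x] unfolding sub[of x] k_def[symmetric] y_def[symmetric]
      by (simp add: sub y_def)
  qed
  then show ?thesis
    using assms finite_subset[OF assms(2)]
    by (simp add: ribbon_hypermap_def sub_hypermap_def K_def)
qed

end

theory Submission
  imports Defs
begin

text \<open>
  Everything except the vertex and face counts cancels, leaving
  \<open>v(H\<^sup>A) + f(H\<^sup>A) = f(A) + f(A\<^sup>c)\<close>.  Moving the ends of the new arrows to their places on \<open>H\<close>, the
  vertex curves of \<open>H\<^sup>A\<close> alternate between arcs of \<open>H\<close> and a matching that follows the free arcs of
  hyperedges in \<open>A\<close> and the arrows outside \<open>A\<close>; for the face curves the roles of \<open>A\<close> and \<open>A\<^sup>c\<close> are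
  exchanged.  Contracting the arrows outside \<open>A\<close> turns the former curves into the boundary
  components of the sub-hypermap \<open>A\<close>, so \<open>v(H\<^sup>A) = f(A)\<close> and \<open>f(H\<^sup>A) = f(A\<^sup>c)\<close> up to the hyperedges
  without segments.
\<close>

section \<open>Closed curves as orbits, and their transport along maps\<close>

definition step_rel :: "'a set \<Rightarrow> ('a \<Rightarrow> 'a) \<Rightarrow> ('a \<Rightarrow> 'a) \<Rightarrow> ('a \<times> 'a) set" where
  "step_rel X f g = (\<lambda>x. (x, f x)) ` X \<union> (\<lambda>x. (x, g x)) ` X"

lemma closed_curves_eq: "closed_curves X f g = (\<lambda>x. (step_rel X f g)\<^sup>* `` {x}) ` X"
  by (auto simp: closed_curves_def step_rel_def quotient_def)

lemma step_rel_iff: "(x, y) \<in> step_rel X f g \<longleftrightarrow> x \<in> X \<and> (y = f x \<or> y = g x)"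
  by (auto simp: step_rel_def)

lemma rtrancl_step_rel_in:
  assumes "f ` X \<subseteq> X" "g ` X \<subseteq> X" "(x, y) \<in> (step_rel X f g)\<^sup>*" "x \<in> X"
  shows "y \<in> X"
  using assms(3,4) by induction (use assms(1,2) in \<open>auto simp: step_rel_iff\<close>)

lemma closed_curves_subset:
  assumes "f ` X \<subseteq> X" "g ` X \<subseteq> X" "C \<in> closed_curves X f g"
  shows "C \<subseteq> X"
  using assms(3) rtrancl_step_rel_in[OF assms(1,2)] by (auto simp: closed_curves_eq)

text \<open>Steps push forward along \<open>p\<close>, and a step leaving \<open>p y\<close> lifts
  to a step leaving \<open>y\<close>; so a path from \<open>p x\<close> is the image of a path from
  \<open>x\<close>.\<close>

lemma closed_curves_image:
  assumes maps: "f ` X \<subseteq> X" "g ` X \<subseteq> X"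
    and f: "\<And>x. x \<in> X \<Longrightarrow> p (f x) = f' (p x)"
    and g: "\<And>x. x \<in> X \<Longrightarrow> p (g x) = g' (p x)"
  shows "closed_curves (p ` X) f' g' = (`) p ` closed_curves X f g"
proof -
  let ?R = "step_rel X f g" and ?R' = "step_rel (p ` X) f' g'"
  have 1: "(p x, p y) \<in> ?R'\<^sup>*" if "(x, y) \<in> ?R\<^sup>*" for x y
    using that
  proof induction
    case (step y z)
    then have "(p y, p z) \<in> ?R'" using f g by (auto simp: step_rel_iff)
    with step.IH show ?case by (rule rtrancl_into_rtrancl)
  qed simp
  have 2: "\<exists>y. (x, y) \<in> ?R\<^sup>* \<and> z = p y" if "(p x, z) \<in> ?R'\<^sup>*" "x \<in> X" for x z
    using that(1)
  proof induction
    case (step u z)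
    then obtain y where y: "(x, y) \<in> ?R\<^sup>*" "u = p y" by blast
    have "y \<in> X" using rtrancl_step_rel_in[OF maps y(1) that(2)] .
    then have "\<exists>w. (y, w) \<in> ?R \<and> z = p w"
      using step.hyps(2) y(2) f g by (metis step_rel_iff)
    with y(1) show ?case by (blast intro: rtrancl_into_rtrancl)
  qed auto
  have "?R'\<^sup>* `` {p x} = p ` (?R\<^sup>* `` {x})" if "x \<in> X" for x
    using 1 2 that by blast
  then show ?thesis
    by (simp add: closed_curves_eq image_image cong: image_cong)
qed

lemma card_closed_curves_bij_betw:
  assumes bij: "bij_betw p X Y"
    and maps: "f ` X \<subseteq> X" "g ` X \<subseteq> X"
    and "\<And>x. x \<in> X \<Longrightarrow> p (f x) = f' (p x)" "\<And>x. x \<in> X \<Longrightarrow> p (g x) = g' (p x)"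
  shows "card (closed_curves Y f' g') = card (closed_curves X f g)"
proof -
  have "inj_on ((`) p) (closed_curves X f g)"
    using bij closed_curves_subset[OF maps]
    by (intro inj_onI) (metis bij_betw_def inj_on_image_eq_iff)
  moreover have "closed_curves Y f' g' = (`) p ` closed_curves X f g"
    using closed_curves_image[OF maps assms(4,5)] bij by (simp add: bij_betw_def)
  ultimately show ?thesis by (simp add: card_image)
qed

text \<open>Involutions make every step reversible, so reachability is symmetric and curves that
  share a point coincide.\<close>

lemma equiv_rtrancl_step_rel:
  assumes "\<And>x. x \<in> X \<Longrightarrow> f x \<in> X \<and> f (f x) = x"
    and "\<And>x. x \<in> X \<Longrightarrow> g x \<in> X \<and> g (g x) = x"
  shows "equiv UNIV ((step_rel X f g)\<^sup>*)"
proof -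
  have "sym (step_rel X f g)"
    using assms by (intro symI) (auto simp: step_rel_iff)
  then show ?thesis
    by (intro equivI) (auto intro: sym_rtrancl trans_rtrancl refl_rtrancl)
qed

section \<open>Curves that avoid a subset, and first return to it\<close>

lemma closed_curves_disjoint_subset:
  assumes "\<And>x. x \<in> X - K \<Longrightarrow> g x = h x"
  shows "{C \<in> closed_curves X f g. C \<inter> K = {}} \<subseteq> {C \<in> closed_curves X f h. C \<inter> K = {}}"
proof -
  let ?R = "step_rel X f g" and ?S = "step_rel X f h"
  have agree: "(x, y) \<in> ?R \<longleftrightarrow> (x, y) \<in> ?S" if "x \<notin> K" for x y
    using that assms by (auto simp: step_rel_iff)
  have "?R\<^sup>* `` {x} = ?S\<^sup>* `` {x}" if disj: "?R\<^sup>* `` {x} \<inter> K = {}" for x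
  proof -
    have "(x, y) \<in> ?S\<^sup>*" if "(x, y) \<in> ?R\<^sup>*" for y
      using that
    proof induction
      case (step y z)
      then have "y \<notin> K" using disj by blast
      then show ?case using step agree by (meson rtrancl_into_rtrancl)
    qed simp
    \<comment> \<open>By induction \<open>y\<close> lies on the \<open>?R\<close>-curve of
      \<open>x\<close>, so disjointness of that one curve from \<open>K\<close> controls the paths
      of both relations.\<close>
    moreover have "(x, y) \<in> ?R\<^sup>*" if "(x, y) \<in> ?S\<^sup>*" for y
      using that
    proof induction
      case (step y z)
      then have "y \<notin> K" using disj by blast
      then show ?case using step agree by (meson rtrancl_into_rtrancl)
    qed simp
    ultimately show ?thesis by blast
  qed
  then show ?thesis by (auto simp: closed_curves_eq)
qed

text \<open>This is the contraction argument. Cutting a curve down to \<open>K\<close> turns each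
  stretch outside \<open>K\<close> into one application of the first-return map \<open>r\<close>, so
  curves meeting \<open>K\<close> match the curves of \<open>r\<close> and \<open>h\<close>. On
  curves that avoid \<open>K\<close>, \<open>h\<close> is never applied, so these are curves of
  \<open>f\<close> and \<open>g\<close>.\<close>

lemma card_closed_curves_first_return:
  assumes fin: "finite X" and KX: "K \<subseteq> X"
    and f: "\<And>x. x \<in> X \<Longrightarrow> f x \<in> X \<and> f (f x) = x"
    and g: "\<And>x. x \<in> X \<Longrightarrow> g x \<in> X \<and> g (g x) = x"
    and gK: "\<And>x. x \<in> K \<Longrightarrow> g x \<in> K"
    and h: "\<And>x. x \<in> K \<Longrightarrow> h x \<in> K \<and> h (h x) = x"
    and r: "\<And>x. r x = ((f \<circ> g) ^^ (LEAST k. ((f \<circ> g) ^^ k) (f x) \<in> K)) (f x)"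
    and rK: "\<And>x. x \<in> K \<Longrightarrow> r x \<in> K"
  shows "card (closed_curves X f (\<lambda>x. if x \<in> K then h x else g x)) =
    card (closed_curves K r h) + card {C \<in> closed_curves X f g. C \<inter> K = {}}"
proof -
  define t where "t x = (if x \<in> K then h x else g x)" for x
  define walk where "walk x k = ((f \<circ> g) ^^ k) (f x)" for x k
  define len where "len x = (LEAST k. walk x k \<in> K)" for x
  let ?R = "step_rel X f t" and ?Q = "step_rel K r h"
  have r_walk: "r x = walk x (len x)" for x
    by (simp add: r walk_def len_def)
  have walk_0: "walk x 0 = f x" and walk_Suc: "walk x (Suc k) = f (g (walk x k))" for x k
    by (simp_all add: walk_def)
  have walk_X: "walk x k \<in> X" if "x \<in> X" for x k
    using that f g by (induction k) (auto simp: walk_0 walk_Suc)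
  have before: "walk x k \<notin> K" if "k < len x" for x k
    using that not_less_Least unfolding len_def by blast
  have gK': "g x \<notin> K" if "x \<in> X" "x \<notin> K" for x
    using that gK g by metis
  have t: "t x \<in> X \<and> t (t x) = x" if "x \<in> X" for x
    using that g gK' h KX by (auto simp: t_def)
  have eq: "equiv UNIV (?R\<^sup>*)"
    by (rule equiv_rtrancl_step_rel[OF f t])
  have Q_in_R: "(x, y) \<in> ?R\<^sup>*" if "(x, y) \<in> ?Q\<^sup>*" "x \<in> K" for x y
    using that(1)
  proof induction
    case (step y z)
    have y: "y \<in> K" "y \<in> X" using step.hyps(2) KX by (auto simp: step_rel_iff)
    \<comment> \<open>Before time \<open>len y\<close> the walk is outside \<open>K\<close>, where
      \<open>t\<close> is \<open>g\<close>; each of its steps is thus a \<open>t\<close>-step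
      followed by an \<open>f\<close>-step.\<close>
    have "(y, walk y k) \<in> ?R\<^sup>*" if "k \<le> len y" for k
      using that
    proof (induction k)
      case 0
      show ?case using y by (auto simp: walk_0 step_rel_iff)
    next
      case (Suc k)
      have "walk y k \<notin> K" "walk y k \<in> X" using before Suc.prems walk_X y by auto
      then have "(walk y k, g (walk y k)) \<in> ?R" "(g (walk y k), walk y (Suc k)) \<in> ?R"
        using g by (auto simp: step_rel_iff t_def walk_Suc)
      with Suc show ?case by (meson Suc_leD rtrancl.rtrancl_into_rtrancl)
    qed
    then have "(y, r y) \<in> ?R\<^sup>*" by (simp add: r_walk)
    moreover have "(y, h y) \<in> ?R\<^sup>*" using y by (auto simp: step_rel_iff t_def)
    ultimately have "(y, z) \<in> ?R\<^sup>*" using step.hyps(2) by (auto simp: step_rel_iff)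
    with step.IH show ?case by (rule rtrancl_trans)
  qed simp
  have R_in_Q: "(x, y) \<in> ?Q\<^sup>*" if "(x, y) \<in> ?R\<^sup>*" "x \<in> K" "y \<in> K" for x y
  proof -
    define Z where "Z = ?Q\<^sup>* `` {x}"
    have ZK: "Z \<subseteq> K"
      using rtrancl_step_rel_in[of r K h x] rK h that(2) by (auto simp: Z_def)
    have Z: "r z \<in> Z" "h z \<in> Z" if "z \<in> Z" for z
    proof -
      have "(z, r z) \<in> ?Q" "(z, h z) \<in> ?Q" using that ZK by (auto simp: step_rel_iff)
      then show "r z \<in> Z" "h z \<in> Z"
        using that unfolding Z_def by (auto intro: rtrancl_into_rtrancl)
    qed
    \<comment> \<open>The stretches between points of \<open>Z\<close>: closed under \<open>f\<close> and \<open>t\<close>, and meeting \<open>K\<close> only in \<open>Z\<close>.\<close>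
    define W where "W = Z \<union> {g (walk z k) | z k. z \<in> Z \<and> k < len z} \<union>
      {walk z k | z k. z \<in> Z \<and> k \<le> len z}"
    have WI: "z \<in> W" "k < len z \<Longrightarrow> g (walk z k) \<in> W" "k \<le> len z \<Longrightarrow> walk z k \<in> W"
      if "z \<in> Z" for z k
      using that by (auto simp: W_def)
    have WX: "W \<subseteq> X"
      using ZK KX walk_X g by (auto simp: W_def)
    \<comment> \<open>On a stretch, one of \<open>f\<close> and \<open>t\<close> moves forward and
      the other backward. The ends stay in \<open>W\<close> too: \<open>f\<close> leads from
      \<open>walk z 0\<close> back to \<open>z\<close>, and \<open>walk z (len z)\<close> is
      \<open>r z\<close>, a point of \<open>Z\<close>, where \<open>t\<close> is
      \<open>h\<close>.\<close>
    have closed: "f w \<in> W \<and> t w \<in> W" if "w \<in> W" for w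
      using that unfolding W_def[THEN eqset_imp_iff, of w] Un_iff mem_Collect_eq
    proof (elim disjE exE conjE)
      assume "w \<in> Z"
      then show ?thesis
        using WI(1)[OF Z(2)] WI(3)[of w 0] ZK by (auto simp: walk_0 t_def)
    next
      fix z k assume w: "w = g (walk z k)" "z \<in> Z" "k < len z"
      have "walk z k \<in> X" "walk z k \<notin> K" using w ZK KX walk_X before by auto
      then have "t w = walk z k" using w gK' g by (simp add: t_def)
      moreover have "f w = walk z (Suc k)" using w by (simp add: walk_Suc)
      ultimately show ?thesis using WI(3)[OF w(2), of k] WI(3)[OF w(2), of "Suc k"] w(3) by simp
    next
      fix z k assume w: "w = walk z k" "z \<in> Z" "k \<le> len z"
      have z: "z \<in> X" using w ZK KX by auto
      have "f w \<in> W"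
      proof (cases k)
        case 0
        then show ?thesis using w f z WI(1) by (simp add: walk_0)
      next
        case (Suc j)
        then have "f w = g (walk z j)" using w walk_X[OF z] f g by (simp add: walk_Suc)
        then show ?thesis using WI(2)[OF w(2)] Suc w(3) by simp
      qed
      moreover have "t w \<in> W"
      proof (cases "k = len z")
        case True
        then have "w \<in> Z" using w Z(1) by (simp add: r_walk[symmetric])
        then show ?thesis using WI(1) Z(2) ZK by (auto simp: t_def)
      next
        case False
        then show ?thesis using w before[of k z] WI(2)[OF w(2)] by (simp add: t_def)
      qed
      ultimately show ?thesis ..
    qed
    have "x \<in> W" by (rule WI(1)) (simp add: Z_def)
    have "y \<in> W"
      using that(1) \<open>x \<in> W\<close> by induction (use closed in \<open>auto simp: step_rel_iff\<close>)
    moreover have "W \<inter> K \<subseteq> Z"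
    proof
      fix w assume "w \<in> W \<inter> K"
      moreover have "g (walk z k) \<notin> K" if "z \<in> Z" "k < len z" for z k
        using that gK' before walk_X ZK KX by blast
      moreover have "walk z k \<in> Z" if "z \<in> Z" "k \<le> len z" "walk z k \<in> K" for z k
        using that before[of k z] Z(1) r_walk[of z] by (metis le_neq_implies_less)
      ultimately show "w \<in> Z" by (auto simp: W_def)
    qed
    ultimately show ?thesis using that(3) by (auto simp: Z_def)
  qed
  have cut: "?R\<^sup>* `` {x} \<inter> K = ?Q\<^sup>* `` {x}" if "x \<in> K" for x
    using that Q_in_R R_in_Q rtrancl_step_rel_in[of r K h x] rK h by blast
  let ?M = "{C \<in> closed_curves X f t. C \<inter> K \<noteq> {}}"
  have M: "?M = (\<lambda>x. ?R\<^sup>* `` {x}) ` K"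
  proof (intro equalityI subsetI)
    fix C assume "C \<in> ?M"
    then obtain x y where "C = ?R\<^sup>* `` {x}" "(x, y) \<in> ?R\<^sup>*" "y \<in> K"
      by (auto simp: closed_curves_eq)
    then show "C \<in> (\<lambda>x. ?R\<^sup>* `` {x}) ` K"
      using equiv_class_eq[OF eq] by blast
  qed (use KX in \<open>auto simp: closed_curves_eq\<close>)
  have image: "(\<lambda>C. C \<inter> K) ` ?M = closed_curves K r h"
    unfolding M closed_curves_eq[of K] image_image using cut by (intro image_cong) auto
  \<comment> \<open>Equal traces on \<open>K\<close> are nonempty, so the two curves share a point
    and are the same class.\<close>
  have inj: "inj_on (\<lambda>C. C \<inter> K) ?M"
  proof (rule inj_onI)
    fix C D assume CD: "C \<in> ?M" "D \<in> ?M" "C \<inter> K = D \<inter> K"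
    then obtain z where "z \<in> C" "z \<in> D" by blast
    moreover obtain x y where "C = ?R\<^sup>* `` {x}" "D = ?R\<^sup>* `` {y}"
      using CD by (auto simp: closed_curves_eq)
    ultimately show "C = D"
      using equiv_class_eq[OF eq, of x z] equiv_class_eq[OF eq, of y z] by auto
  qed
  have card_M: "card ?M = card (closed_curves K r h)"
    using card_image[OF inj] by (simp only: image)
  have disj: "{C \<in> closed_curves X f t. C \<inter> K = {}} = {C \<in> closed_curves X f g. C \<inter> K = {}}"
    by (intro equalityI closed_curves_disjoint_subset) (auto simp: t_def)
  have "finite (closed_curves X f t)"
    using fin by (simp add: closed_curves_eq)
  then have "card (?M \<union> {C \<in> closed_curves X f t. C \<inter> K = {}}) =
      card ?M + card {C \<in> closed_curves X f t. C \<inter> K = {}}"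
    by (intro card_Un_disjoint) auto
  moreover have "?M \<union> {C \<in> closed_curves X f t. C \<inter> K = {}} = closed_curves X f t"
    by blast
  ultimately have "card (closed_curves X f t) = card (closed_curves K r h) +
      card {C \<in> closed_curves X f g. C \<inter> K = {}}"
    by (simp only: card_M disj)
  then show ?thesis
    by (simp add: t_def[abs_def])
qed

section \<open>Free arcs of hyperedges and the places of the new arrows\<close>

lemma Suc_mod_pred_mod:
  assumes "i < n"
  shows "(Suc i mod n + n - Suc 0) mod n = i" "Suc ((i + n - Suc 0) mod n) mod n = i"
proof -
  show "(Suc i mod n + n - Suc 0) mod n = i"
    using assms by (auto simp: mod_Suc)
  show "Suc ((i + n - Suc 0) mod n) mod n = i"
    using assms by (simp add: mod_Suc_eq)
qed

lemma hedge_arc_in_arrow_ends: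
  "x \<in> arrow_ends E (hdeg H) \<Longrightarrow> hedge_arc H x \<in> arrow_ends E (hdeg H)"
  by (cases x) auto

lemma hedge_arc_hedge_arc:
  "x \<in> arrow_ends E (hdeg H) \<Longrightarrow> hedge_arc H (hedge_arc H x) = x"
  by (cases x) (auto simp: Suc_mod_pred_mod)

text \<open>For \<open>e\<close> in \<open>A\<close> the new arrow \<open>i\<close> lies along the
  free arc from old head \<open>i\<close> to old tail \<open>i + 1\<close>, so traversing it means
  following \<open>hedge_arc\<close>; the other arrows stay where they are.\<close>

lemma place_other_end:
  assumes "x \<in> ends H"
  shows "place H A (other_end x) =
    (if place H A x \<in> arrow_ends A (hdeg H) then hedge_arc H (place H A x)
     else other_end (place H A x))"
  using assms by (cases x) (auto simp: Suc_mod_pred_mod)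

text \<open>For \<open>e\<close> in \<open>A\<close> the free arc after new arrow \<open>i\<close>
  runs from the tail to the head of old arrow \<open>i + 1\<close>. This exchanges the roles of
  \<open>A\<close> and its complement.\<close>

lemma place_hedge_arc:
  assumes "x \<in> ends H"
  shows "place H A (hedge_arc H x) =
    (if place H A x \<in> arrow_ends (hedges H - A) (hdeg H) then hedge_arc H (place H A x)
     else other_end (place H A x))"
  using assms by (cases x) (auto simp: Suc_mod_pred_mod)

lemma hedge_arc_eqI: "hdeg H = hdeg H' \<Longrightarrow> hedge_arc H x = hedge_arc H' x"
  by (cases x) auto

section \<open>Counts for sub-hypermaps and partial duals\<close>

text \<open>First return with \<open>g = other_end\<close> and \<open>h = hedge_arc\<close>: the
  curves avoiding the arrows of \<open>A\<close> are exactly those that become bare in the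
  sub-hypermap.\<close>

lemma num_hfaces_sub_hypermap:
  assumes "ribbon_hypermap H" "A \<subseteq> hedges H"
  shows "num_hfaces (sub_hypermap H A) =
    card (closed_curves (ends H) (arc H)
      (\<lambda>x. if x \<in> arrow_ends A (hdeg H) then hedge_arc H x else other_end x)) +
    bare H + card {e \<in> A. hdeg H e = 0}"
proof -
  let ?K = "arrow_ends A (hdeg H)"
  have rib: "ribbon_hypermap (sub_hypermap H A)"
    by (rule ribbon_hypermap_sub_hypermap[OF assms])
  have "card (closed_curves (ends H) (arc H)
      (\<lambda>x. if x \<in> ?K then hedge_arc H x else other_end x)) =
    card (closed_curves ?K (sub_arc H A) (hedge_arc H)) +
    card {C \<in> hvertex_curves H. C \<inter> ?K = {}}"
  proof (rule card_closed_curves_first_return)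
    show "finite (ends H)" using assms by (simp add: ribbon_hypermap_def finite_arrow_ends)
    show "?K \<subseteq> ends H" using assms(2) by (auto simp: arrow_ends_def)
    show "sub_arc H A x \<in> ?K" if "x \<in> ?K" for x
      using rib that by (simp add: ribbon_hypermap_def sub_hypermap_def)
  qed (use assms in \<open>auto simp: ribbon_hypermap_def sub_arc_def hedge_arc_in_arrow_ends
      hedge_arc_hedge_arc\<close>)
  moreover have "hedge_arc (sub_hypermap H A) = hedge_arc H"
    by (rule ext, rule hedge_arc_eqI) (simp add: sub_hypermap_def)
  ultimately show ?thesis
    by (simp add: num_hfaces_def sub_hypermap_def)
qed

text \<open>\<open>place\<close> is a bijection that conjugates the arcs of the dual to those of
  \<open>H\<close>.\<close>

lemma closed_curves_partial_dual:
  assumes "ribbon_hypermap H"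
    and "\<And>x. x \<in> ends H \<Longrightarrow> g x \<in> ends H"
    and "\<And>x. x \<in> ends H \<Longrightarrow> place H A (g x) = g' (place H A x)"
  shows "card (closed_curves (ends H) (arc (partial_dual H A)) g) =
    card (closed_curves (ends H) (arc H) g')"
proof (rule card_closed_curves_bij_betw[symmetric])
  show bij: "bij_betw (place H A) (ends H) (ends H)"
    using assms(1) by (simp add: bij_betw_place ribbon_hypermap_def)
  show "arc (partial_dual H A) ` ends H \<subseteq> ends H"
    using ribbon_hypermap_partial_dual[OF assms(1), of A]
    by (auto simp: ribbon_hypermap_def partial_dual_def)
  fix x assume "x \<in> ends H"
  then have "arc H (place H A x) \<in> ends H"
    using bij assms(1) by (auto simp: ribbon_hypermap_def bij_betw_def)
  then show "place H A (arc (partial_dual H A) x) = arc H (place H A x)"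
    using bij by (simp add: partial_dual_def bij_betw_def f_inv_into_f)
qed (use assms in auto)

text \<open>A hyperedge of \<open>A\<close> without segments contributes a face to the sub-hypermap
  but no vertex to the dual, hence the correction term.\<close>

lemma num_hvertices_partial_dual:
  assumes "ribbon_hypermap H" "A \<subseteq> hedges H"
  shows "num_hvertices (partial_dual H A) + card {e \<in> A. hdeg H e = 0} =
    num_hfaces (sub_hypermap H A)"
  using closed_curves_partial_dual[where A = A and g = other_end and
      g' = "\<lambda>x. if x \<in> arrow_ends A (hdeg H) then hedge_arc H x else other_end x",
      OF assms(1) _ place_other_end]
    num_hfaces_sub_hypermap[OF assms]
  by (simp add: num_hvertices_def) (simp add: partial_dual_def)

text \<open>The dual keeps all hyperedges without segments as faces, while the complement of
  \<open>A\<close> sees only its own. The surplus cancels the correction in the vertex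
  count.\<close>

lemma num_hfaces_partial_dual:
  assumes "ribbon_hypermap H" "A \<subseteq> hedges H"
  shows "num_hfaces (partial_dual H A) =
    num_hfaces (sub_hypermap H (hedges H - A)) + card {e \<in> A. hdeg H e = 0}"
proof -
  have "finite (hedges H)" using assms(1) by (simp add: ribbon_hypermap_def)
  then have "card {e \<in> hedges H. hdeg H e = 0} =
      card {e \<in> hedges H - A. hdeg H e = 0} + card {e \<in> A. hdeg H e = 0}"
    using assms(2) finite_subset[OF assms(2)]
    by (subst card_Un_disjoint[symmetric]) (auto intro: arg_cong[of _ _ card])
  moreover have "hedge_arc (partial_dual H A) = hedge_arc H"
    by (rule ext, rule hedge_arc_eqI) (simp add: partial_dual_def)
  ultimately show ?thesis
    using closed_curves_partial_dual[where A = A and g = "hedge_arc H" and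
        g' = "\<lambda>x. if x \<in> arrow_ends (hedges H - A) (hdeg H) then hedge_arc H x else other_end x",
        OF assms(1) hedge_arc_in_arrow_ends place_hedge_arc]
      num_hfaces_sub_hypermap[OF assms(1), of "hedges H - A"]
    by (simp add: num_hfaces_def) (simp add: partial_dual_def)
qed

lemma num_hvertices_sub_hypermap:
  assumes "ribbon_hypermap H" "A \<subseteq> hedges H"
  shows "num_hvertices (sub_hypermap H A) = num_hvertices H"
proof -
  let ?K = "arrow_ends A (hdeg H)"
  have rib: "ribbon_hypermap (sub_hypermap H A)"
    by (rule ribbon_hypermap_sub_hypermap[OF assms])
  \<comment> \<open>First return with \<open>h\<close> equal to \<open>g\<close>: the conditional
    has equal branches and only serves to match the form of the lemma.\<close>
  have "card (closed_curves (ends H) (arc H) (\<lambda>x. if x \<in> ?K then other_end x else other_end x)) =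
    card (closed_curves ?K (sub_arc H A) other_end) +
    card {C \<in> hvertex_curves H. C \<inter> ?K = {}}"
  proof (rule card_closed_curves_first_return)
    show "finite (ends H)" using assms by (simp add: ribbon_hypermap_def finite_arrow_ends)
    show "?K \<subseteq> ends H" using assms(2) by (auto simp: arrow_ends_def)
    show "sub_arc H A x \<in> ?K" if "x \<in> ?K" for x
      using rib that by (simp add: ribbon_hypermap_def sub_hypermap_def)
  qed (use assms in \<open>auto simp: ribbon_hypermap_def sub_arc_def\<close>)
  then show ?thesis
    by (simp add: num_hvertices_def sub_hypermap_def)
qed

theorem theorem3p3:
  fixes H :: "'e arrow_presentation" and A :: "'e set"
  assumes "ribbon_hypermap H" and "A \<subseteq> hedges H"
  shows "euler_char (partial_dual H A) =
    euler_char (sub_hypermap H A) + euler_char (sub_hypermap H (hedges H - A))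
      - 2 * int (num_hvertices H)"
proof -
  have fin: "finite (hedges H)" using assms(1) by (simp add: ribbon_hypermap_def)
  have "card (hedges H) = card A + card (hedges H - A)"
    using fin assms(2) by (simp add: card_Diff_subset card_mono finite_subset)
  moreover have "sum (hdeg H) (hedges H) = sum (hdeg H) (hedges H - A) + sum (hdeg H) A"
    by (rule sum.subset_diff[OF assms(2) fin])
  moreover have "num_hedges (partial_dual H A) = card (hedges H)"
    "num_segments (partial_dual H A) = sum (hdeg H) (hedges H)"
    by (simp_all add: num_hedges_def num_segments_def partial_dual_def)
  moreover have "num_hedges (sub_hypermap H B) = card B"
    "num_segments (sub_hypermap H B) = sum (hdeg H) B" for B
    by (simp_all add: num_hedges_def num_segments_def sub_hypermap_def)
  \<comment> \<open>Hyperedge and segment counts add up over \<open>A\<close> and its complement;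
    each part has the hypervertex count of \<open>H\<close>, which accounts for the term
    \<open>2 * int (num_hvertices H)\<close>.\<close>
  ultimately show ?thesis
    using num_hvertices_partial_dual[OF assms] num_hfaces_partial_dual[OF assms]
      num_hvertices_sub_hypermap[OF assms]
      num_hvertices_sub_hypermap[OF assms(1), of "hedges H - A"]
    by (simp add: euler_char_def)
qed

end
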